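(* The algebraic variety $X$ of flexes of plane cubics, i.e. the closed subset $$X=\{a\in\mathbb P(U)\times\mathbb P(V)\mid F(a)=H(a)=0\}$$ of $\mathbb P(U)\times\mathbb P(V)$, is irreducible.
   Context: Everything is over $\mathbb C$, and topological terms refer to the Zariski topology. $V=\mathbb C^3$ with standard coordinate functions $x_0,x_1,x_2\in V^*$; $U={\sf S}^3(V^* )$ is the $10$-dimensional vector space of degree $3$ forms on $V$, with basis the monomials $x_0^{i_0}x_1^{i_1}x_2^{i_2}$, $i_0+i_1+i_2=3$, and $\{\alpha_{i_0i_1i_2}\}$ is the dual basis of $U^*$. $\mathbb P(V)$, $\mathbb P(U)$ are the projective spaces of one-dimensional linear subspaces. On $\mathbb P(U)\times\mathbb P(V)$ consider the (bihomogeneous) forms $$F=\sum_{i_0+i_1+i_2=3}\alpha_{i_0i_1i_2}x_0^{i_0}x_1^{i_1}x_2^{i_2},\qquad H=\det\Big(\frac{\partial^2F}{\partial x_i\partial x_j}\Big)_{0\le i,j\le 2}.$$ *)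

theory Defs
  imports "HOL-Analysis.Analysis"
begin

definition projective_space :: "(complex ^ 'n) set set" where
  "projective_space = {L. vec.subspace L \<and> vec.dim L = 1}"

definition exponents :: "nat \<Rightarrow> ('n::finite \<Rightarrow> nat) set" where
  "exponents d = {p. (\<Sum>i\<in>UNIV. p i) = d}"

definition monomial :: "('n::finite \<Rightarrow> nat) \<Rightarrow> complex ^ 'n \<Rightarrow> complex" where
  "monomial p x = (\<Prod>i\<in>UNIV. (x $ i) ^ p i)"

definition bihomogeneous ::
  "nat \<Rightarrow> nat \<Rightarrow> (complex ^ 'm \<Rightarrow> complex ^ 'n \<Rightarrow> complex) \<Rightarrow> bool" where
  "bihomogeneous d e f \<longleftrightarrow>
    (\<exists>c. \<forall>u v. f u v =
      (\<Sum>p\<in>exponents d. \<Sum>q\<in>exponents e. c p q * monomial p u * monomial q v))"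

text \<open>Over the infinite field of complex numbers, polynomials and polynomial functions agree, so
  forms are represented by the functions they define.\<close>

definition biforms :: "(complex ^ 'm \<Rightarrow> complex ^ 'n \<Rightarrow> complex) set" where
  "biforms = {f. \<exists>d e. bihomogeneous d e f}"

text \<open>A form vanishes at a pair of lines if it vanishes on all representatives; for a
  bihomogeneous form this does not depend on the representatives.\<close>

definition zero_locus ::
  "(complex ^ 'm \<Rightarrow> complex ^ 'n \<Rightarrow> complex) set \<Rightarrow> ((complex ^ 'm) set \<times> (complex ^ 'n) set) set" where
  "zero_locus T = {(L, M) \<in> projective_space \<times> projective_space.
     \<forall>f\<in>T. \<forall>u\<in>L - {0}. \<forall>v\<in>M - {0}. f u v = 0}"

definition zariski_biprojective :: "((complex ^ 'm) set \<times> (complex ^ 'n) set) topology" where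
  "zariski_biprojective = topology (\<lambda>S. \<exists>T\<subseteq>biforms.
     S = projective_space \<times> projective_space - zero_locus T)"

definition irreducible_space :: "'a topology \<Rightarrow> bool" where
  "irreducible_space X \<longleftrightarrow> topspace X \<noteq> {} \<and>
     (\<forall>A B. closedin X A \<and> closedin X B \<and> A \<union> B = topspace X \<longrightarrow>
        A = topspace X \<or> B = topspace X)"

lemma finite_exponents: "finite (exponents d :: ('n::finite \<Rightarrow> nat) set)"
proof (rule finite_subset)
  show "(exponents d :: ('n \<Rightarrow> nat) set) \<subseteq> Pi\<^sub>E UNIV (\<lambda>_. {..d})"
  proof
    fix p :: "'n \<Rightarrow> nat" assume "p \<in> exponents d"
    hence "p i \<le> d" for i
      using member_le_sum[of i UNIV p] by (simp add: exponents_def)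
    thus "p \<in> Pi\<^sub>E UNIV (\<lambda>_. {..d})" by auto
  qed
qed (intro finite_PiE; simp)

typedef cubic_exponent = "exponents 3 :: (3 \<Rightarrow> nat) set"
  by (rule exI[of _ "\<lambda>_. 1"]) (simp add: exponents_def)

instance cubic_exponent :: finite
proof
  have "finite (Abs_cubic_exponent ` exponents 3)"
    using finite_exponents by blast
  thus "finite (UNIV :: cubic_exponent set)"
    using type_definition.Abs_image[OF type_definition_cubic_exponent] by simp
qed

text \<open>The space of ternary cubic forms is \<^typ>\<open>complex ^ cubic_exponent\<close>: a form is given by its
  coordinates in the basis of monomials, so \<open>\<alpha>\<^sub>e(u)\<close> is \<open>u $ e\<close>.
  The indices of \<^typ>\<open>complex ^ 3\<close> are \<open>0, 1, 2 :: 3\<close>.\<close>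

definition cubic_F :: "complex ^ cubic_exponent \<Rightarrow> complex ^ 3 \<Rightarrow> complex" where
  "cubic_F u x = (\<Sum>e\<in>UNIV. u $ e * monomial (Rep_cubic_exponent e) x)"

definition partial_deriv :: "'n \<Rightarrow> (complex ^ 'n \<Rightarrow> complex) \<Rightarrow> complex ^ 'n \<Rightarrow> complex" where
  "partial_deriv i f x = deriv (\<lambda>t. f (x + axis i t)) 0"

definition hessian_H :: "complex ^ cubic_exponent \<Rightarrow> complex ^ 3 \<Rightarrow> complex" where
  "hessian_H u x =
     det ((\<chi> i j. partial_deriv i (partial_deriv j (cubic_F u)) x) :: complex ^ 3 ^ 3)"

definition flex_variety :: "((complex ^ cubic_exponent) set \<times> (complex ^ 3) set) set" where
  "flex_variety = zero_locus {cubic_F, hessian_H}"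

lemma monomial_mult: "monomial p x * monomial q x = monomial (\<lambda>i. p i + q i) x"
  by (simp add: monomial_def power_add prod.distrib)

lemma bihomogeneous_0: "bihomogeneous d e (\<lambda>u v. 0)"
  unfolding bihomogeneous_def by (rule exI[of _ "\<lambda>_ _. 0"]) simp

lemma bihomogeneous_add:
  assumes "bihomogeneous d e f" "bihomogeneous d e g"
  shows "bihomogeneous d e (\<lambda>u v. f u v + g u v)"
proof -
  obtain a b where
    "\<forall>u v. f u v = (\<Sum>p\<in>exponents d. \<Sum>q\<in>exponents e. a p q * monomial p u * monomial q v)"
    "\<forall>u v. g u v = (\<Sum>p\<in>exponents d. \<Sum>q\<in>exponents e. b p q * monomial p u * monomial q v)"
    using assms unfolding bihomogeneous_def by blast
  thus ?thesis unfolding bihomogeneous_def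
    by (intro exI[of _ "\<lambda>p q. a p q + b p q"]) (simp add: distrib_right sum.distrib)
qed

lemma bihomogeneous_sum:
  assumes "\<And>i. i \<in> I \<Longrightarrow> bihomogeneous d e (f i)"
  shows "bihomogeneous d e (\<lambda>u v. \<Sum>i\<in>I. f i u v)"
  using assms
  by (induction I rule: infinite_finite_induct) (auto intro: bihomogeneous_0 bihomogeneous_add)

lemma bihomogeneous_monomial:
  assumes "p \<in> exponents d" "q \<in> exponents e"
  shows "bihomogeneous d e (\<lambda>u v. c * monomial p u * monomial q v)"
proof -
  let ?c = "\<lambda>p' q'. if p' = p then if q' = q then c else 0 else 0"
  have "(\<Sum>p'\<in>exponents d. \<Sum>q'\<in>exponents e. ?c p' q' * monomial p' u * monomial q' v)
      = c * monomial p u * monomial q v" for u v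
  proof -
    have "(\<Sum>p'\<in>exponents d. \<Sum>q'\<in>exponents e. ?c p' q' * monomial p' u * monomial q' v)
      = (\<Sum>p'\<in>exponents d. if p' = p then
           (\<Sum>q'\<in>exponents e. if q' = q then c * monomial p u * monomial q v else 0) else 0)"
      by (intro sum.cong refl) (auto intro!: sum.cong)
    thus ?thesis using assms by (simp add: finite_exponents)
  qed
  thus ?thesis unfolding bihomogeneous_def by (intro exI[of _ ?c]) simp
qed

lemma bihomogeneous_mult:
  assumes "bihomogeneous d e f" "bihomogeneous d' e' g"
  shows "bihomogeneous (d + d') (e + e') (\<lambda>u v. f u v * g u v)"
proof -
  obtain a b where
    f: "\<And>u v. f u v = (\<Sum>p\<in>exponents d. \<Sum>q\<in>exponents e. a p q * monomial p u * monomial q v)" and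
    g: "\<And>u v. g u v = (\<Sum>p\<in>exponents d'. \<Sum>q\<in>exponents e'. b p q * monomial p u * monomial q v)"
    using assms unfolding bihomogeneous_def by blast
  have eq: "f u v * g u v = (\<Sum>p\<in>exponents d. \<Sum>p'\<in>exponents d'. \<Sum>q\<in>exponents e. \<Sum>q'\<in>exponents e'.
      (a p q * b p' q') * monomial (\<lambda>i. p i + p' i) u * monomial (\<lambda>i. q i + q' i) v)" for u v
    unfolding f g sum_product monomial_mult[symmetric] by (simp add: mult_ac)
  show ?thesis unfolding eq
    by (intro bihomogeneous_sum bihomogeneous_monomial) (auto simp: exponents_def sum.distrib)
qed

lemma bihomogeneous_cmult:
  assumes "bihomogeneous d e f"
  shows "bihomogeneous d e (\<lambda>u v. c * f u v)"
proof -
  obtain a where "\<forall>u v. f u v = (\<Sum>p\<in>exponents d. \<Sum>q\<in>exponents e. a p q * monomial p u * monomial q v)"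
    using assms unfolding bihomogeneous_def by blast
  thus ?thesis unfolding bihomogeneous_def
    by (intro exI[of _ "\<lambda>p q. c * a p q"]) (simp add: sum_distrib_left mult_ac)
qed

lemma monomial_scale:
  assumes "p \<in> exponents d"
  shows "monomial p (s *s x) = s ^ d * monomial p x"
  using assms by (simp add: monomial_def exponents_def power_mult_distrib prod.distrib flip: power_sum)

lemma bihomogeneous_scale:
  assumes "bihomogeneous d e f"
  shows "f (s *s u) (t *s v) = s ^ d * t ^ e * f u v"
proof -
  obtain a where f: "\<And>u v. f u v = (\<Sum>p\<in>exponents d. \<Sum>q\<in>exponents e. a p q * monomial p u * monomial q v)"
    using assms unfolding bihomogeneous_def by blast
  show ?thesis unfolding f
    by (simp add: sum_distrib_left monomial_scale mult_ac)
qed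

lemma projective_space_line:
  assumes "L \<in> projective_space" "u \<in> L" "u \<noteq> 0" "w \<in> L"
  obtains s where "w = s *s u"
proof -
  have "vec.span {u} = L"
    using assms vec.card_ge_dim_independent[of "{u}" L] vec.span_subspace[of "{u}" L]
    by (auto simp: projective_space_def)
  thus thesis using assms(4) that by (auto simp: vec.span_singleton)
qed

lemma projective_space_nonzero:
  assumes "L \<in> projective_space"
  obtains u where "u \<in> L" "u \<noteq> 0"
proof -
  have "\<not> L \<subseteq> {0}" using assms vec.dim_eq_0[of L] by (auto simp: projective_space_def)
  thus thesis using that by auto
qed

lemma vanishes_at_representative:
  assumes "bihomogeneous d e f" "L \<in> projective_space" "M \<in> projective_space"
    and "u \<in> L - {0}" "v \<in> M - {0}" "f u v = 0" "u' \<in> L - {0}" "v' \<in> M - {0}"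
  shows "f u' v' = 0"
proof -
  obtain s where "u' = s *s u" using assms projective_space_line by (metis DiffE singletonI)
  moreover obtain t where "v' = t *s v" using assms projective_space_line by (metis DiffE singletonI)
  ultimately show ?thesis using bihomogeneous_scale[OF assms(1)] assms(6) by simp
qed

lemma zero_locus_Union: "zero_locus (\<Union>\<T>) = (projective_space \<times> projective_space) \<inter> (\<Inter>T\<in>\<T>. zero_locus T)"
  by (auto simp: zero_locus_def)

lemma zero_locus_mult:
  assumes "S \<subseteq> biforms" "T \<subseteq> biforms"
  shows "zero_locus {(\<lambda>u v. f u v * g u v) | f g. f \<in> S \<and> g \<in> T} = zero_locus S \<union> zero_locus T"
proof (intro equalityI subsetI)
  fix z assume z: "z \<in> zero_locus {(\<lambda>u v. f u v * g u v) | f g. f \<in> S \<and> g \<in> T}"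
  obtain L M where zLM: "z = (L, M)" by (cases z)
  have LM: "L \<in> projective_space" "M \<in> projective_space"
    using z by (auto simp: zLM zero_locus_def)
  have prod: "f u v * g u v = 0" if "f \<in> S" "g \<in> T" "u \<in> L - {0}" "v \<in> M - {0}" for f g u v
  proof -
    have "(\<lambda>u v. f u v * g u v) \<in> {(\<lambda>u v. f u v * g u v) | f g. f \<in> S \<and> g \<in> T}" using that by blast
    thus ?thesis using z that(3,4) unfolding zLM zero_locus_def by fast
  qed
  show "z \<in> zero_locus S \<union> zero_locus T"
  proof (rule ccontr)
    assume "z \<notin> zero_locus S \<union> zero_locus T"
    then obtain f u v g u' v' where fg: "f \<in> S" "u \<in> L - {0}" "v \<in> M - {0}" "f u v \<noteq> 0"
      "g \<in> T" "u' \<in> L - {0}" "v' \<in> M - {0}" "g u' v' \<noteq> 0"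
      using LM unfolding zLM zero_locus_def by blast
    hence "g u v = 0" using prod[of f g u v] by simp
    moreover obtain d e where "bihomogeneous d e g" using fg assms by (auto simp: biforms_def)
    ultimately show False using vanishes_at_representative[of d e g L M u v u' v'] LM fg by blast
  qed
next
  fix z assume "z \<in> zero_locus S \<union> zero_locus T"
  thus "z \<in> zero_locus {(\<lambda>u v. f u v * g u v) | f g. f \<in> S \<and> g \<in> T}"
    unfolding zero_locus_def by fastforce
qed

lemma zero_locus_subset: "zero_locus T \<subseteq> projective_space \<times> projective_space"
  by (auto simp: zero_locus_def)

lemma istopology_zariski:
  "istopology (\<lambda>S. \<exists>T\<subseteq>biforms. S = projective_space \<times> projective_space - zero_locus T)"
proof -
  let ?P = "projective_space \<times> projective_space"
  show ?thesis unfolding istopology_def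
  proof (intro conjI allI impI)
    fix A B :: "((complex ^ 'a) set \<times> (complex ^ 'b) set) set"
    assume "\<exists>T\<subseteq>biforms. A = ?P - zero_locus T" "\<exists>T\<subseteq>biforms. B = ?P - zero_locus T"
    then obtain S T where ST: "S \<subseteq> biforms" "A = ?P - zero_locus S" "T \<subseteq> biforms" "B = ?P - zero_locus T"
      by blast
    have "{(\<lambda>u v. f u v * g u v) | f g. f \<in> S \<and> g \<in> T} \<subseteq> biforms"
      using ST(1,3) unfolding biforms_def by (blast intro: bihomogeneous_mult)
    moreover have "A \<inter> B = ?P - zero_locus {(\<lambda>u v. f u v * g u v) | f g. f \<in> S \<and> g \<in> T}"
      unfolding zero_locus_mult[OF ST(1,3)] using ST by blast
    ultimately show "\<exists>T\<subseteq>biforms. A \<inter> B = ?P - zero_locus T" by blast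
  next
    fix \<K> :: "((complex ^ 'a) set \<times> (complex ^ 'b) set) set set"
    assume "\<forall>K\<in>\<K>. \<exists>T\<subseteq>biforms. K = ?P - zero_locus T"
    then obtain t where t: "\<And>K. K \<in> \<K> \<Longrightarrow> t K \<subseteq> biforms \<and> K = ?P - zero_locus (t K)" by metis
    have "\<Union>\<K> = ?P - zero_locus (\<Union>(t ` \<K>))"
      unfolding zero_locus_Union using t by fast
    moreover have "\<Union>(t ` \<K>) \<subseteq> biforms" using t by blast
    ultimately show "\<exists>T\<subseteq>biforms. \<Union>\<K> = ?P - zero_locus T" by blast
  qed
qed

lemma openin_zariski:
  "openin zariski_biprojective S \<longleftrightarrow>
     (\<exists>T\<subseteq>biforms. S = projective_space \<times> projective_space - zero_locus T)"
  unfolding zariski_biprojective_def topology_inverse'[OF istopology_zariski] ..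

lemma topspace_zariski:
  "topspace zariski_biprojective = projective_space \<times> projective_space"
proof -
  have "bihomogeneous 0 0 (\<lambda>u v. 1 :: complex)"
    using bihomogeneous_monomial[of "\<lambda>_. 0" 0 "\<lambda>_. 0" 0 1]
    by (simp add: exponents_def monomial_def)
  hence "{\<lambda>u v. 1} \<subseteq> biforms" by (auto simp: biforms_def)
  moreover have "zero_locus {\<lambda>u v. 1} = {}"
    by (auto simp: zero_locus_def elim!: projective_space_nonzero)
  ultimately have "openin zariski_biprojective (projective_space \<times> projective_space)"
    unfolding openin_zariski by (metis Diff_empty)
  thus ?thesis
    unfolding topspace_def using openin_zariski by blast
qed

lemma closedin_zariski:
  "closedin zariski_biprojective C \<longleftrightarrow> (\<exists>T\<subseteq>biforms. C = zero_locus T)"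
proof
  assume "closedin zariski_biprojective C"
  then obtain T where T: "C \<subseteq> projective_space \<times> projective_space" "T \<subseteq> biforms"
    "projective_space \<times> projective_space - C = projective_space \<times> projective_space - zero_locus T"
    unfolding closedin_def topspace_zariski openin_zariski by (elim conjE exE) simp
  have "C = zero_locus T" using T(1,3) zero_locus_subset[of T] by (simp add: set_eq_iff subset_iff) blast
  thus "\<exists>T\<subseteq>biforms. C = zero_locus T" using T(2) by (intro exI[of _ T] conjI)
next
  assume "\<exists>T\<subseteq>biforms. C = zero_locus T"
  thus "closedin zariski_biprojective C"
    unfolding closedin_def topspace_zariski openin_zariski
    using zero_locus_subset by (elim exE conjE) (intro conjI exI, simp_all)
qed

lemma bihomogeneous_cubic_F: "bihomogeneous 1 3 cubic_F"
proof -
  have "u $ e * x = monomial (\<lambda>i. if i = e then 1 else 0) u * x"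
    for u :: "complex ^ cubic_exponent" and e x
  proof -
    have "monomial (\<lambda>i. if i = e then 1 else 0) u = (\<Prod>i\<in>UNIV. if i = e then u $ i else 1)"
      unfolding monomial_def by (intro prod.cong) auto
    thus ?thesis by simp
  qed
  note coordinate = this
  have "cubic_F = (\<lambda>u x. \<Sum>e\<in>UNIV. 1 * monomial (\<lambda>i. if i = e then 1 else 0) u
      * monomial (Rep_cubic_exponent e) x)"
    unfolding cubic_F_def by (intro ext sum.cong refl) (simp only: mult_1 flip: coordinate)
  moreover have "bihomogeneous 1 3 \<dots>"
    by (intro bihomogeneous_sum bihomogeneous_monomial)
      (auto simp: Rep_cubic_exponent, simp add: exponents_def)
  ultimately show ?thesis by metis
qed

lemma monomial_has_partial_deriv:
  "((\<lambda>t. monomial q (x + axis i t)) has_field_derivative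
     of_nat (q i) * monomial (q(i := q i - 1)) x) (at 0)"
proof -
  have split: "monomial r y = (y $ i) ^ r i * (\<Prod>k\<in>UNIV - {i}. (y $ k) ^ r k)" for r y
    unfolding monomial_def by (subst prod.remove[of _ i]) auto
  have eq: "monomial q (x + axis i t) = (x $ i + t) ^ q i * (\<Prod>k\<in>UNIV - {i}. (x $ k) ^ q k)" for t
    unfolding split by (simp add: axis_def)
  have "((\<lambda>t. (x $ i + t) ^ q i * (\<Prod>k\<in>UNIV - {i}. (x $ k) ^ q k)) has_field_derivative
      of_nat (q i) * (x $ i) ^ (q i - 1) * (\<Prod>k\<in>UNIV - {i}. (x $ k) ^ q k)) (at 0)"
    by (auto intro!: derivative_eq_intros)
  moreover have "of_nat (q i) * monomial (q(i := q i - 1)) x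
      = of_nat (q i) * (x $ i) ^ (q i - 1) * (\<Prod>k\<in>UNIV - {i}. (x $ k) ^ q k)"
    unfolding split by (simp add: mult_ac)
  ultimately show ?thesis unfolding eq by (simp only:)
qed

lemma bihomogeneous_partial_deriv:
  assumes "bihomogeneous d (Suc e) f"
  shows "bihomogeneous d e (\<lambda>u. partial_deriv i (f u))"
proof -
  obtain a where f: "\<And>u v. f u v =
      (\<Sum>p\<in>exponents d. \<Sum>q\<in>exponents (Suc e). a p q * monomial p u * monomial q v)"
    using assms unfolding bihomogeneous_def by blast
  have "((\<lambda>t. f u (v + axis i t)) has_field_derivative
      (\<Sum>p\<in>exponents d. \<Sum>q\<in>exponents (Suc e).
        a p q * monomial p u * (of_nat (q i) * monomial (q(i := q i - 1)) v))) (at 0)" for u v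
    unfolding f by (intro DERIV_sum DERIV_cmult monomial_has_partial_deriv)
  hence "(\<lambda>u v. partial_deriv i (f u) v) = (\<lambda>u v. \<Sum>p\<in>exponents d. \<Sum>q\<in>exponents (Suc e).
        a p q * monomial p u * (of_nat (q i) * monomial (q(i := q i - 1)) v))"
    unfolding partial_deriv_def by (intro ext DERIV_imp_deriv)
  moreover have "bihomogeneous d e \<dots>"
  proof (intro bihomogeneous_sum)
    fix p :: "'a \<Rightarrow> nat" and q :: "'b \<Rightarrow> nat"
    assume p: "p \<in> exponents d" and q: "q \<in> exponents (Suc e)"
    show "bihomogeneous d e (\<lambda>u v. a p q * monomial p u * (of_nat (q i) * monomial (q(i := q i - 1)) v))"
    proof (cases "q i = 0")
      case True
      thus ?thesis by (simp add: bihomogeneous_0)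
    next
      case False
      have "(\<Sum>k\<in>UNIV. q k) = q i + (\<Sum>k\<in>UNIV - {i}. q k)"
        by (rule sum.remove) auto
      moreover have "(\<Sum>k\<in>UNIV. (q(i := q i - 1)) k) = (q i - 1) + (\<Sum>k\<in>UNIV - {i}. q k)"
        by (subst sum.remove[of _ i]) auto
      ultimately have "q(i := q i - 1) \<in> exponents e"
        using q False unfolding exponents_def by auto
      from bihomogeneous_monomial[OF p this, of "a p q * of_nat (q i)"]
      show ?thesis by (simp add: mult_ac)
    qed
  qed
  ultimately show ?thesis by simp
qed

lemma bihomogeneous_hessian_H: "bihomogeneous 3 3 hessian_H"
proof -
  let ?D = "\<lambda>i j u. partial_deriv i (partial_deriv j (cubic_F u))"
  have D: "bihomogeneous 1 1 (?D i j)" for i j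
    using bihomogeneous_cubic_F
    by (intro bihomogeneous_partial_deriv) (simp add: numeral_eq_Suc)
  have prod: "bihomogeneous (card I) (card I) (\<lambda>u x. \<Prod>i\<in>I. ?D i (p i) u x)" if "finite I" for p and I :: "3 set"
    using that
  proof induction
    case empty
    show ?case using bihomogeneous_monomial[of "\<lambda>_. 0" 0 "\<lambda>_. 0" 0 1]
      by (simp add: exponents_def monomial_def)
  next
    case (insert i I)
    thus ?case using bihomogeneous_mult[OF D insert.IH] by simp
  qed
  have "bihomogeneous 3 3 (\<lambda>u x. \<Prod>i\<in>UNIV. ?D i (p i) u x)" for p
    using prod[of UNIV p] by simp
  hence "bihomogeneous 3 3 (\<lambda>u x. \<Sum>p | p permutes UNIV. of_int (sign p) * (\<Prod>i\<in>UNIV. ?D i (p i) u x))"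
    by (intro bihomogeneous_sum bihomogeneous_cmult)
  thus ?thesis unfolding hessian_H_def det_def by simp
qed

lemma closedin_flex_variety: "closedin zariski_biprojective flex_variety"
proof -
  have "{cubic_F, hessian_H} \<subseteq> biforms"
    unfolding biforms_def using bihomogeneous_cubic_F bihomogeneous_hessian_H by simp blast
  thus ?thesis unfolding closedin_zariski flex_variety_def by blast
qed

end

theory Submission
  imports Defs
begin

text \<open>A point \<open>v\<close> of a cubic \<open>F = 0\<close> is a flex when some line through \<open>v\<close> either lies in the cubic or
  meets it at \<open>v\<close> with multiplicity at least three. If \<open>l\<close> is an equation of that line and \<open>n\<close>
  is another linear form vanishing at \<open>v\<close>, the restriction of \<open>F\<close> to \<open>l = 0\<close> is a multiple of
  \<open>n\<^sup>3\<close>, hence \<open>F = l Q + c n\<^sup>3\<close> for a quadratic form \<open>Q\<close> and a scalar \<open>c\<close>, while \<open>v\<close>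
  is the cross product of \<open>n\<close> and \<open>l\<close> up to a factor that can be absorbed. So the flex
  variety is parametrised, through polynomial formulas, by the vector space of all \<open>(l, n, Q, c)\<close>,
  as \<open>flex_cubic_flex\<close> and \<open>flex_is_flex_cubic\<close> show. This is the reason for irreducibility.

  The vanishing of the Hessian determinant at \<open>v\<close> yields the line: the Hessian matrix at \<open>v\<close> is
  the matrix of the polar conic of \<open>v\<close>, which passes through \<open>v\<close> and is degenerate, so it
  contains a line through \<open>v\<close> (\<open>degenerate_conic_contains_line\<close>). A second point \<open>w\<close> of
  this line satisfies \<open>T(v, v, w) = T(v, w, w) = 0\<close> for the symmetric trilinear form \<open>T\<close> with
  \<open>F(y) = T(y, y, y)\<close>, and so \<open>F\<close> restricts to \<open>F(s v + t w) = t\<^sup>3 F(w)\<close>.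

  Irreducibility needs only line segments in the parameter space. The segment between
  parameters of two flexes gives a curve with polynomial coordinates that
  joins them and whose points are flexes wherever its two vectors are nonzero
  (\<open>flexes_joined_by_polynomial_curve\<close>). If two proper closed subsets
  covered the variety, there would be a biform vanishing on the first but not at one flex,
  and a biform vanishing on the second but not at another flex. Along the curve that joins these two
  flexes both biforms, and some coordinate in each factor, are nonzero polynomials in one variable.
  Somewhere all of them are nonzero, and there the curve has a flex in neither subset.\<close>

section \<open>Lines on degenerate conics\<close>

abbreviation dot :: "complex ^ 3 \<Rightarrow> complex ^ 3 \<Rightarrow> complex" where
  "dot \<equiv> scalar_product"

text \<open>The index \<open>3 :: 3\<close> equals \<open>0\<close>, so the coordinates \<open>1, 2, 3\<close> below are
  \<open>x\<^sub>1, x\<^sub>2, x\<^sub>0\<close>.\<close>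

definition cross :: "complex ^ 3 \<Rightarrow> complex ^ 3 \<Rightarrow> complex ^ 3" where
  "cross a b = vector [a $ 2 * b $ 3 - a $ 3 * b $ 2, a $ 3 * b $ 1 - a $ 1 * b $ 3, a $ 1 * b $ 2 - a $ 2 * b $ 1]"

lemma dot_cross_left: "dot a (cross a b) = 0" "dot b (cross a b) = 0"
  by (simp_all add: scalar_product_def cross_def sum_3 vector_3 algebra_simps)

lemma cross_eq_0_imp_multiple:
  assumes "cross v w = 0" "v \<noteq> 0"
  shows "\<exists>s. w = s *s v"
proof -
  have c: "v $ 2 * w $ 3 = v $ 3 * w $ 2" "v $ 3 * w $ 1 = v $ 1 * w $ 3" "v $ 1 * w $ 2 = v $ 2 * w $ 1"
    using assms(1) by (auto simp: cross_def vec_eq_iff forall_3 vector_3)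
  obtain i where i: "v $ i \<noteq> 0" using assms(2) by (auto simp: vec_eq_iff)
  have "v $ i * w $ j = w $ i * v $ j" for j
    using c exhaust_3[of i] exhaust_3[of j] by (metis mult.commute)
  hence "w = (w $ i / v $ i) *s v"
    using i by (simp add: vec_eq_iff nonzero_eq_divide_eq mult.commute)
  thus ?thesis ..
qed

text \<open>A kernel vector of \<open>A\<close> outside the line spanned by \<open>v\<close> is a singular point of the conic, and
  the line joining it to \<open>v\<close> lies on the conic. If instead \<open>v\<close> itself lies in the kernel, the conic
  is a cone with vertex \<open>v\<close> over the zeros of a binary quadratic form on a complement of \<open>v\<close>;
  over the complex numbers such zeros exist.\<close>
lemma degenerate_conic_contains_line:
  fixes A :: "complex ^ 3 ^ 3"
  assumes sym: "transpose A = A" and det: "det A = 0" and v: "v \<noteq> 0" and vv: "dot v (A *v v) = 0"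
  obtains w where "cross v w \<noteq> 0" "dot v (A *v w) = 0" "dot w (A *v w) = 0"
proof -
  have S: "A $ i $ j = A $ j $ i" for i j
  proof -
    have "transpose A $ j $ i = A $ i $ j" by (simp add: transpose_def)
    thus ?thesis by (simp add: sym)
  qed
  have selfadjoint: "dot a (A *v b) = dot b (A *v a)" for a b
    unfolding scalar_product_def matrix_vector_mult_def
    by (simp add: sum_3 S[of 2 1] S[of 3 1] S[of 3 2]) (simp add: algebra_simps)
  obtain k where k: "k \<noteq> 0" "A *v k = 0"
    using det invertible_det_nz[of A] invertible_left_inverse[of A] matrix_left_invertible_ker[of A] by blast
  show thesis
  proof (cases "cross v k = 0")
    case False
    have "dot a 0 = 0" for a by (simp add: scalar_product_def)
    thus thesis using that[of k] False k by simp
  next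
    case True
    then obtain s where s: "k = s *s v" using cross_eq_0_imp_multiple v by blast
    hence "A *v v = 0" using k
      by (auto simp: vector_scalar_commute)
    hence vw: "dot v (A *v w) = 0" for w
      unfolding selfadjoint[of v] by (simp add: scalar_product_def)
    obtain i where i: "v $ i \<noteq> 0" using v by (auto simp: vec_eq_iff)
    have iso: "\<exists>p q. (p \<noteq> 0 \<or> q \<noteq> 0) \<and> p\<^sup>2 * a + 2 * p * q * b + q\<^sup>2 * d = 0" for a b d :: complex
    proof (cases "a = 0")
      case True thus ?thesis by (intro exI[of _ 1] exI[of _ 0]) simp
    next
      case False
      define x where "x = (csqrt (b\<^sup>2 - a * d) - b) / a"
      have "a * x + b = csqrt (b\<^sup>2 - a * d)" using False by (simp add: x_def)
      hence "(a * x + b)\<^sup>2 = b\<^sup>2 - a * d" by simp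
      hence "a * (x\<^sup>2 * a + 2 * x * 1 * b + 1\<^sup>2 * d) = 0"
        by (simp add: algebra_simps power2_eq_square)
      hence "x\<^sup>2 * a + 2 * x * 1 * b + 1\<^sup>2 * d = 0" using False by simp
      thus ?thesis by (metis one_neq_zero)
    qed
    \<comment> \<open>Since \<open>v $ i\<close> is nonzero, the other two coordinate vectors span a complement of \<open>v\<close>.\<close>
    have "\<exists>w. cross v w \<noteq> 0 \<and> dot w (A *v w) = 0"
    proof -
      have d: "dot w (A *v w) = (\<Sum>i\<in>UNIV. \<Sum>j\<in>UNIV. A $ i $ j * w $ i * w $ j)" for w
        by (simp add: scalar_product_def matrix_vector_mult_def sum_distrib_left mult_ac)
      consider "i = 1" | "i = 2" | "i = 3" using exhaust_3[of i] by blast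
      thus ?thesis
      proof cases
        case 1
        obtain p q where "p \<noteq> 0 \<or> q \<noteq> 0" "p\<^sup>2 * A $ 2 $ 2 + 2 * p * q * A $ 2 $ 3 + q\<^sup>2 * A $ 3 $ 3 = 0" using iso by blast
        with i 1 show ?thesis
          by (intro exI[of _ "vector [0, p, q]"])
             (auto simp: d cross_def vec_eq_iff forall_3 vector_3 sum_3 S[of 3 2] power2_eq_square algebra_simps)
      next
        case 2
        obtain p q where "p \<noteq> 0 \<or> q \<noteq> 0" "p\<^sup>2 * A $ 1 $ 1 + 2 * p * q * A $ 1 $ 3 + q\<^sup>2 * A $ 3 $ 3 = 0" using iso by blast
        with i 2 show ?thesis
          by (intro exI[of _ "vector [p, 0, q]"])
             (auto simp: d cross_def vec_eq_iff forall_3 vector_3 sum_3 S[of 3 1] power2_eq_square algebra_simps)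
      next
        case 3
        obtain p q where "p \<noteq> 0 \<or> q \<noteq> 0" "p\<^sup>2 * A $ 1 $ 1 + 2 * p * q * A $ 1 $ 2 + q\<^sup>2 * A $ 2 $ 2 = 0" using iso by blast
        with i 3 show ?thesis
          by (intro exI[of _ "vector [p, q, 0]"])
             (auto simp: d cross_def vec_eq_iff forall_3 vector_3 sum_3 S[of 2 1] power2_eq_square algebra_simps)
      qed
    qed
    thus thesis using that vw by blast
  qed
qed

section \<open>Ternary cubics as trilinear forms\<close>

definition trilinear :: "(3 \<Rightarrow> 3 \<Rightarrow> 3 \<Rightarrow> complex) \<Rightarrow> complex ^ 3 \<Rightarrow> complex ^ 3 \<Rightarrow> complex ^ 3 \<Rightarrow> complex" where
  "trilinear T a b c = (\<Sum>i\<in>UNIV. \<Sum>j\<in>UNIV. \<Sum>k\<in>UNIV. T i j k * a $ i * b $ j * c $ k)"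

lemma trilinear_add:
  "trilinear T (a + a') b c = trilinear T a b c + trilinear T a' b c"
  "trilinear T a (b + b') c = trilinear T a b c + trilinear T a b' c"
  "trilinear T a b (c + c') = trilinear T a b c + trilinear T a b c'"
  by (simp_all add: trilinear_def algebra_simps sum.distrib)

lemma trilinear_scale:
  "trilinear T (s *s a) b c = s * trilinear T a b c"
  "trilinear T a (s *s b) c = s * trilinear T a b c"
  "trilinear T a b (s *s c) = s * trilinear T a b c"
  by (simp_all add: trilinear_def sum_distrib_left mult_ac)

lemma trilinear_zero: "trilinear T 0 b c = 0" "trilinear T a 0 c = 0" "trilinear T a b 0 = 0"
  by (simp_all add: trilinear_def)

definition symmetric_tensor :: "(3 \<Rightarrow> 3 \<Rightarrow> 3 \<Rightarrow> complex) \<Rightarrow> bool" where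
  "symmetric_tensor T \<longleftrightarrow> (\<forall>i j k. T i j k = T j i k \<and> T i j k = T i k j)"

lemma trilinear_symmetric:
  assumes "symmetric_tensor T"
  shows "trilinear T a b c = trilinear T b a c" "trilinear T a b c = trilinear T a c b"
proof -
  have T: "T i j k = T j i k" "T i j k = T i k j" for i j k
    using assms unfolding symmetric_tensor_def by blast+
  show "trilinear T a b c = trilinear T b a c" unfolding trilinear_def
    by (subst sum.swap) (simp add: T(1) mult_ac)
  show "trilinear T a b c = trilinear T a c b" unfolding trilinear_def
    by (rule sum.cong[OF refl], subst sum.swap) (simp add: T(2) mult_ac)
qed

definition triple_exponent :: "3 \<Rightarrow> 3 \<Rightarrow> 3 \<Rightarrow> 3 \<Rightarrow> nat" where
  "triple_exponent i j k = (\<lambda>s. of_bool (s = i) + of_bool (s = j) + of_bool (s = k))"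

lemma triple_exponent_in_exponents: "triple_exponent i j k \<in> exponents 3"
  by (simp add: exponents_def triple_exponent_def sum.distrib)

lemma monomial_triple_exponent: "monomial (triple_exponent i j k) y = y $ i * y $ j * y $ k"
proof -
  have "monomial (\<lambda>s. of_bool (s = i)) y = y $ i" for i :: 3
  proof -
    have "monomial (\<lambda>s. of_bool (s = i)) y = (\<Prod>s\<in>UNIV. if s = i then y $ s else 1)"
      unfolding monomial_def by (intro prod.cong) auto
    thus ?thesis by simp
  qed
  thus ?thesis unfolding triple_exponent_def by (simp flip: monomial_mult)
qed

lemma exponents_3_triple:
  assumes "p \<in> exponents 3"
  shows "\<exists>i j k. p = triple_exponent i j k"
proof -
  have peel: "\<exists>i. \<exists>q \<in> exponents d. p = (\<lambda>s. of_bool (s = i) + q s)"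
    if p: "p \<in> exponents (Suc d)" for p :: "3 \<Rightarrow> nat" and d
  proof -
    have "\<exists>i. p i \<noteq> 0"
    proof (rule ccontr)
      assume "\<nexists>i. p i \<noteq> 0"
      thus False using p by (simp add: exponents_def)
    qed
    then obtain i where i: "p i > 0" by auto
    let ?q = "\<lambda>s. p s - of_bool (s = i)"
    have eq: "p = (\<lambda>s. of_bool (s = i) + ?q s)" using i by auto
    have "sum p UNIV = 1 + sum ?q UNIV" by (subst eq) (simp add: sum.distrib)
    hence "?q \<in> exponents d" using p by (simp add: exponents_def)
    thus ?thesis using eq by (intro exI[of _ i] bexI[of _ ?q])
  qed
  obtain i q where q: "q \<in> exponents 2" "p = (\<lambda>s. of_bool (s = i) + q s)"
    using peel[of p 2] assms by (auto simp: eval_nat_numeral)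
  obtain j r where r: "r \<in> exponents 1" "q = (\<lambda>s. of_bool (s = j) + r s)"
    using peel[of q 1] q by (auto simp: eval_nat_numeral)
  obtain k t where t: "t \<in> exponents 0" "r = (\<lambda>s. of_bool (s = k) + t s)"
    using peel[of r 0] r by auto
  have "t = (\<lambda>s. 0)" using t by (auto simp: exponents_def)
  thus ?thesis using q r t by (intro exI[of _ i] exI[of _ j] exI[of _ k]) (auto simp: triple_exponent_def)
qed

definition cubic_of_tensor :: "(3 \<Rightarrow> 3 \<Rightarrow> 3 \<Rightarrow> complex) \<Rightarrow> complex ^ cubic_exponent" where
  "cubic_of_tensor T = (\<chi> e. \<Sum>i\<in>UNIV. \<Sum>j\<in>UNIV. \<Sum>k\<in>UNIV.
     of_bool (Rep_cubic_exponent e = triple_exponent i j k) * T i j k)"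

lemma cubic_F_cubic_of_tensor: "cubic_F (cubic_of_tensor T) y = trilinear T y y y"
proof -
  have pick: "(\<Sum>e\<in>UNIV. of_bool (Rep_cubic_exponent e = triple_exponent i j k) * T i j k
      * monomial (Rep_cubic_exponent e) y) = T i j k * y $ i * y $ j * y $ k" for i j k
  proof -
    let ?e = "Abs_cubic_exponent (triple_exponent i j k)"
    have "Rep_cubic_exponent e = triple_exponent i j k \<longleftrightarrow> e = ?e" for e
      by (metis Abs_cubic_exponent_inverse Rep_cubic_exponent_inverse triple_exponent_in_exponents)
    hence "(\<Sum>e\<in>UNIV. of_bool (Rep_cubic_exponent e = triple_exponent i j k) * T i j k
      * monomial (Rep_cubic_exponent e) y) = (\<Sum>e\<in>UNIV. if e = ?e then T i j k * monomial (Rep_cubic_exponent e) y else 0)"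
      by (intro sum.cong) auto
    thus ?thesis by (simp add: Abs_cubic_exponent_inverse triple_exponent_in_exponents monomial_triple_exponent mult_ac)
  qed
  have "cubic_F (cubic_of_tensor T) y = (\<Sum>e\<in>UNIV. \<Sum>i\<in>UNIV. \<Sum>j\<in>UNIV. \<Sum>k\<in>UNIV.
      of_bool (Rep_cubic_exponent e = triple_exponent i j k) * T i j k * monomial (Rep_cubic_exponent e) y)"
    unfolding cubic_F_def cubic_of_tensor_def by (simp only: sum_distrib_right vec_lambda_beta)
  also have "\<dots> = (\<Sum>i\<in>UNIV. \<Sum>j\<in>UNIV. \<Sum>k\<in>UNIV. \<Sum>e\<in>UNIV.
      of_bool (Rep_cubic_exponent e = triple_exponent i j k) * T i j k * monomial (Rep_cubic_exponent e) y)"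
    by (simp only: sum.swap[where A = "UNIV :: cubic_exponent set" and B = "UNIV :: 3 set"])
  finally show ?thesis unfolding pick trilinear_def .
qed

text \<open>Polarization: the coefficient of each monomial is shared equally among the triples of indices
  that produce it.\<close>
lemma cubic_has_symmetric_tensor:
  obtains T where "symmetric_tensor T" "u = cubic_of_tensor T"
proof -
  let ?N = "\<lambda>p. \<Sum>i\<in>UNIV. \<Sum>j\<in>UNIV. \<Sum>k\<in>UNIV. of_bool (p = triple_exponent i j k) :: nat"
  have N: "?N p \<noteq> 0" if "p \<in> exponents 3" for p
    using exponents_3_triple[OF that] by (auto)
  define d where "d = (\<lambda>p. u $ Abs_cubic_exponent p / of_nat (?N p))"
  define T where "T = (\<lambda>i j k. d (triple_exponent i j k))"
  have sw: "triple_exponent i j k = triple_exponent j i k" "triple_exponent i j k = triple_exponent i k j" for i j k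
    by (auto simp: triple_exponent_def)
  have "symmetric_tensor T"
    unfolding symmetric_tensor_def T_def by (metis sw)
  moreover have "u $ e = cubic_of_tensor T $ e" for e
  proof -
    let ?p = "Rep_cubic_exponent e"
    have "cubic_of_tensor T $ e = (\<Sum>i\<in>UNIV. \<Sum>j\<in>UNIV. \<Sum>k\<in>UNIV.
       of_bool (?p = triple_exponent i j k) * d ?p)"
      unfolding cubic_of_tensor_def T_def vec_lambda_beta
      by (intro sum.cong refl) auto
    also have "\<dots> = of_nat (?N ?p) * d ?p"
      by (simp only: sum_distrib_right of_nat_sum of_nat_of_bool)
    also have "d ?p = u $ e / of_nat (?N ?p)"
      unfolding d_def Rep_cubic_exponent_inverse ..
    also have "of_nat (?N ?p) * (u $ e / of_nat (?N ?p)) = u $ e" using N[OF Rep_cubic_exponent[of e]] by (simp only: of_nat_eq_0_iff nonzero_mult_div_cancel_left times_divide_eq_right not_False_eq_True)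
    finally show ?thesis ..
  qed
  ultimately show thesis using that[of T] by (simp add: vec_eq_iff)
qed

text \<open>Monomials of degree three are linearly independent as functions. On the curve
  \<open>(x\<^sub>1, x\<^sub>2, x\<^sub>0) = (1, s, s\<^sup>4)\<close> distinct monomials become distinct powers of \<open>s\<close>, because
  the exponents are at most three.\<close>
lemma cubic_F_injective:
  assumes "cubic_F u = cubic_F u'"
  shows "u = u'"
proof -
  let ?w = "\<lambda>e. Rep_cubic_exponent e 2 + 4 * Rep_cubic_exponent e 3"
  have inj: "e = e'" if "?w e = ?w e'" for e e'
  proof -
    have s: "Rep_cubic_exponent e 1 + Rep_cubic_exponent e 2 + Rep_cubic_exponent e 3 = 3" for e
      using Rep_cubic_exponent[of e] by (simp add: exponents_def sum_3)
    have "a = a' \<and> b = b' \<and> c = c'"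
      if "a + b + c = 3" "a' + b' + c' = 3" "b + 4 * c = b' + 4 * c'" for a b c a' b' c' :: nat
    proof -
      have "\<not> c < c'" "\<not> c' < c" using that by linarith+
      thus ?thesis using that by linarith
    qed
    hence "\<forall>i. Rep_cubic_exponent e i = Rep_cubic_exponent e' i"
      unfolding forall_3 using s[of e] s[of e'] that by blast
    thus ?thesis by (metis Rep_cubic_exponent_inject ext)
  qed
  define p where "p = (\<Sum>e\<in>UNIV. monom (u $ e - u' $ e) (?w e))"
  have "poly p s = 0" for s
  proof -
    have "monomial (Rep_cubic_exponent e) (vector [1, s, s ^ 4]) = s ^ ?w e" for e
      unfolding monomial_def UNIV_3 by (simp add: vector_3 power_add power_mult)
    hence "poly p s = cubic_F u (vector [1, s, s ^ 4]) - cubic_F u' (vector [1, s, s ^ 4])"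
      by (simp add: p_def poly_sum poly_monom cubic_F_def left_diff_distrib sum_subtractf)
    thus ?thesis using assms by simp
  qed
  hence "p = 0" by (simp add: poly_all_0_iff_0[symmetric])
  hence "0 = coeff p (?w e)" for e by simp
  moreover have "coeff p (?w e) = u $ e - u' $ e" for e
  proof -
    have "coeff p (?w e) = (\<Sum>e'\<in>UNIV. if e' = e then u $ e' - u' $ e' else 0)"
      unfolding p_def coeff_sum by (intro sum.cong) (auto dest: inj)
    thus ?thesis by simp
  qed
  ultimately show ?thesis by (simp add: vec_eq_iff)
qed

lemma trilinear_has_derivative:
  "((\<lambda>t. trilinear T (a + t *s a') (b + t *s b') (c + t *s c')) has_field_derivative
      trilinear T a' b c + trilinear T a b' c + trilinear T a b c') (at 0)"
  unfolding trilinear_add trilinear_scale by (auto intro!: derivative_eq_intros)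

lemma second_partial_deriv_cubic:
  assumes F: "\<And>y. cubic_F u y = trilinear T y y y"
  shows "partial_deriv i (partial_deriv j (cubic_F u)) x =
    trilinear T x (axis i 1) (axis j 1) + trilinear T x (axis j 1) (axis i 1) +
    trilinear T (axis i 1) x (axis j 1) + trilinear T (axis j 1) x (axis i 1) +
    trilinear T (axis i 1) (axis j 1) x + trilinear T (axis j 1) (axis i 1) x"
proof -
  define e :: "3 \<Rightarrow> complex ^ 3" where "e = (\<lambda>i. axis i 1)"
  have ax: "axis i t = t *s e i" for i :: 3 and t :: complex
    by (simp add: axis_def vec_eq_iff e_def)
  let ?e = "e j" and ?d = "e i"
  have 1: "partial_deriv j (cubic_F u) x = trilinear T ?e x x + trilinear T x ?e x + trilinear T x x ?e" for x
    unfolding partial_deriv_def F ax[of j] by (rule DERIV_imp_deriv[OF trilinear_has_derivative])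
  have "((\<lambda>t. trilinear T (?e + t *s 0) (x + t *s ?d) (x + t *s ?d) + trilinear T (x + t *s ?d) (?e + t *s 0) (x + t *s ?d)
     + trilinear T (x + t *s ?d) (x + t *s ?d) (?e + t *s 0)) has_field_derivative
     (trilinear T 0 x x + trilinear T ?e ?d x + trilinear T ?e x ?d) + (trilinear T ?d ?e x + trilinear T x 0 x + trilinear T x ?e ?d)
     + (trilinear T ?d x ?e + trilinear T x ?d ?e + trilinear T x x 0)) (at 0)"
    by (intro DERIV_add trilinear_has_derivative)
  hence "((\<lambda>t. partial_deriv j (cubic_F u) (x + axis i t)) has_field_derivative
     (trilinear T 0 x x + trilinear T ?e ?d x + trilinear T ?e x ?d) + (trilinear T ?d ?e x + trilinear T x 0 x + trilinear T x ?e ?d)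
     + (trilinear T ?d x ?e + trilinear T x ?d ?e + trilinear T x x 0)) (at 0)"
    unfolding 1 ax[of i] by simp
  from DERIV_imp_deriv[OF this] show ?thesis unfolding partial_deriv_def[of i] e_def
    by (simp add: trilinear_zero)
qed

section \<open>The parametrisation of flexes\<close>

text \<open>This is the cubic \<open>l Q + c n\<^sup>3\<close> with \<open>Q(y)\<close> the quadratic form of the matrix \<open>q\<close>. The
  tensor is not symmetrised, which keeps its entries simple polynomials in the parameters.\<close>
definition flex_cubic :: "complex ^ 3 \<Rightarrow> complex ^ 3 \<Rightarrow> complex ^ 3 ^ 3 \<Rightarrow> complex \<Rightarrow> complex ^ cubic_exponent" where
  "flex_cubic l n q c = cubic_of_tensor (\<lambda>i j k. l $ i * q $ j $ k + c * n $ i * n $ j * n $ k)"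

lemma trilinear_flex_cubic:
  "trilinear (\<lambda>i j k. l $ i * q $ j $ k + c * n $ i * n $ j * n $ k) x y z =
     dot l x * dot y (q *v z) + c * dot n x * dot n y * dot n z"
proof -
  have "dot l x * dot y (q *v z) = (\<Sum>i\<in>UNIV. \<Sum>j\<in>UNIV. \<Sum>k\<in>UNIV. l $ i * q $ j $ k * x $ i * y $ j * z $ k)"
    by (simp add: scalar_product_def matrix_vector_mult_def sum_3) (simp add: algebra_simps)
  moreover have "c * dot n x * dot n y * dot n z = (\<Sum>i\<in>UNIV. \<Sum>j\<in>UNIV. \<Sum>k\<in>UNIV. c * n $ i * n $ j * n $ k * x $ i * y $ j * z $ k)"
    by (simp add: scalar_product_def sum_3 algebra_simps)
  ultimately show ?thesis unfolding trilinear_def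
    by (simp add: distrib_right sum.distrib)
qed

lemma cubic_F_flex_cubic:
  "cubic_F (flex_cubic l n q c) y = dot l y * dot y (q *v y) + c * dot n y ^ 3"
  unfolding flex_cubic_def cubic_F_cubic_of_tensor trilinear_flex_cubic
  by (simp add: power3_eq_cube mult_ac)

text \<open>Both \<open>l\<close> and \<open>n\<close> vanish at their cross product, so in the Hessian of \<open>l Q + c n\<^sup>3\<close> there
  only the terms survive in which \<open>l\<close> is differentiated exactly once. They form a
  matrix \<open>l r\<^sup>T + r l\<^sup>T\<close>, with \<open>r\<close> the gradient of \<open>Q\<close>; its rank is at most two.\<close>
lemma flex_cubic_flex:
  "cubic_F (flex_cubic l n q c) (cross n l) = 0"
  "hessian_H (flex_cubic l n q c) (cross n l) = 0"
proof -
  let ?x = "cross n l" and ?T = "\<lambda>i j k. l $ i * q $ j $ k + c * n $ i * n $ j * n $ k"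
  show "cubic_F (flex_cubic l n q c) ?x = 0"
    by (simp add: cubic_F_flex_cubic dot_cross_left)
  define r where "r = (\<lambda>j. dot ?x (q *v axis j 1) + dot (axis j 1) (q *v ?x))"
  have dot_axis: "dot a (axis i 1) = a $ i" for a i
    by (simp add: scalar_product_def axis_def if_distrib cong: if_cong)
  have "partial_deriv i (partial_deriv j (cubic_F (flex_cubic l n q c))) ?x = l $ i * r j + l $ j * r i" for i j
  proof -
    have F: "cubic_F (flex_cubic l n q c) y = trilinear ?T y y y" for y
      unfolding flex_cubic_def by (rule cubic_F_cubic_of_tensor)
    show ?thesis unfolding second_partial_deriv_cubic[OF F] trilinear_flex_cubic
      by (simp add: dot_cross_left dot_axis r_def algebra_simps)
  qed
  thus "hessian_H (flex_cubic l n q c) ?x = 0"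
    unfolding hessian_H_def det_3 by (simp add: algebra_simps)
qed

text \<open>The Hessian matrix at \<open>v\<close> is \<open>6 T(v, _, _)\<close> for the polarization \<open>T\<close> of the cubic. With \<open>w\<close> as in
  \<open>degenerate_conic_contains_line\<close> the cubic restricts to \<open>t\<^sup>3 T(w, w, w)\<close> at \<open>s v + t w\<close>.
  Completing \<open>v, w\<close> to a basis by \<open>p\<close> and letting \<open>m, n, l\<close> be the dual basis, the expansion of
  \<open>T\<close> at \<open>y = m(y) v + n(y) w + l(y) p\<close> has, by the choice of \<open>w\<close>, \<open>T(w, w, w) n\<^sup>3\<close> as its only term not divisible by \<open>l\<close>.
  The dual basis consists of cross products because \<open>p\<close> is scaled to determinant one.\<close>
lemma flex_is_flex_cubic:
  assumes v: "v \<noteq> 0" and F: "cubic_F u v = 0" and H: "hessian_H u v = 0"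
  obtains l n q c where "u = flex_cubic l n q c" "v = cross n l"
proof -
  obtain T where T: "symmetric_tensor T" "u = cubic_of_tensor T" by (rule cubic_has_symmetric_tensor)
  have FT: "cubic_F u y = trilinear T y y y" for y unfolding T(2) by (rule cubic_F_cubic_of_tensor)
  define A :: "complex ^ 3 ^ 3" where "A = (\<chi> i j. 6 * trilinear T v (axis i 1) (axis j 1))"
  have trilinear_A: "dot a (A *v b) = 6 * trilinear T v a b" for a b
  proof -
    have ex: "y = (\<Sum>i\<in>UNIV. y $ i *s axis i 1)" for y :: "complex ^ 3"
      by (simp add: vec_eq_iff sum_3 forall_3 axis_def)
    have "trilinear T v a b = trilinear T v (\<Sum>i\<in>UNIV. a $ i *s axis i 1) (\<Sum>i\<in>UNIV. b $ i *s axis i 1)"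
      using ex by metis
    thus ?thesis unfolding sum_3 trilinear_add trilinear_scale
      by (simp add: scalar_product_def matrix_vector_mult_def A_def sum_3 algebra_simps)
  qed
  have A: "A = (\<chi> i j. partial_deriv i (partial_deriv j (cubic_F u)) v)"
  proof -
    have "partial_deriv i (partial_deriv j (cubic_F u)) v = 6 * trilinear T v (axis i 1) (axis j 1)" for i j
    proof -
      have "trilinear T v b a = trilinear T v a b" "trilinear T a v b = trilinear T v a b" "trilinear T b v a = trilinear T v a b"
        "trilinear T a b v = trilinear T v a b" "trilinear T b a v = trilinear T v a b" for a b
        using trilinear_symmetric[OF T(1)] by metis+
      thus ?thesis unfolding second_partial_deriv_cubic[OF FT] by simp
    qed
    thus ?thesis by (simp add: A_def)
  qed
  have "transpose A = A"
    unfolding A_def transpose_def using trilinear_symmetric(2)[OF T(1)] by (auto simp: vec_eq_iff)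
  moreover have "det A = 0" using H unfolding hessian_H_def A .
  moreover have "dot v (A *v v) = 0" using F FT trilinear_A by simp
  ultimately obtain w where w: "cross v w \<noteq> 0" "dot v (A *v w) = 0" "dot w (A *v w) = 0"
    using degenerate_conic_contains_line v by blast
  have zero: "trilinear T v v v = 0" "trilinear T v v w = 0" "trilinear T v w w = 0"
    using w trilinear_A F FT by auto
  define l where "l = cross v w"
  obtain i where i: "l $ i \<noteq> 0" using w(1) by (auto simp: vec_eq_iff l_def)
  define p :: "complex ^ 3" where "p = (1 / l $ i) *s axis i 1"
  have lp: "dot l p = 1" using i by (simp add: scalar_product_def p_def axis_def if_distrib cong: if_cong)
  define m where "m = cross w p"
  define n where "n = cross p v"
  have basis: "y = dot m y *s v + dot n y *s w + dot l y *s p" for y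
  proof -
    have "dot l p *s y = dot m y *s v + dot n y *s w + dot l y *s p"
      unfolding m_def n_def l_def
      by (simp add: vec_eq_iff forall_3 scalar_product_def cross_def sum_3 vector_3) (simp add: algebra_simps)
    thus ?thesis by (simp add: lp)
  qed
  have "cross n l = v"
  proof -
    have "cross n l = dot l p *s v"
      unfolding n_def l_def
      by (simp add: vec_eq_iff forall_3 scalar_product_def cross_def sum_3 vector_3) (simp add: algebra_simps)
    thus ?thesis by (simp add: lp)
  qed
  \<comment> \<open>the quotient by \<open>l\<close> of all terms of the expansion that are divisible by \<open>l\<close>\<close>
  define q :: "complex ^ 3 ^ 3" where "q = (\<chi> j k. 3 * trilinear T v v p * m $ j * m $ k + 6 * trilinear T v w p * m $ j * n $ k
     + 3 * trilinear T w w p * n $ j * n $ k + 3 * trilinear T v p p * m $ j * l $ k + 3 * trilinear T w p p * n $ j * l $ k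
     + trilinear T p p p * l $ j * l $ k)"
  have q: "dot y (q *v y) = 3 * trilinear T v v p * dot m y ^ 2 + 6 * trilinear T v w p * dot m y * dot n y
     + 3 * trilinear T w w p * dot n y ^ 2 + 3 * trilinear T v p p * dot m y * dot l y + 3 * trilinear T w p p * dot n y * dot l y
     + trilinear T p p p * dot l y ^ 2" for y
    by (simp add: scalar_product_def matrix_vector_mult_def q_def sum_3 power2_eq_square) (simp add: algebra_simps)
  have expand: "trilinear T (a *s v + b *s w + g *s p) (a *s v + b *s w + g *s p) (a *s v + b *s w + g *s p) =
     g * (3 * trilinear T v v p * a ^ 2 + 6 * trilinear T v w p * a * b
     + 3 * trilinear T w w p * b ^ 2 + 3 * trilinear T v p p * a * g + 3 * trilinear T w p p * b * g
     + trilinear T p p p * g ^ 2) + trilinear T w w w * b ^ 3" for a b g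
  proof -
    have s: "trilinear T w v v = 0" "trilinear T v w v = 0" "trilinear T w w v = 0" "trilinear T w v w = 0"
      "trilinear T p v v = trilinear T v v p" "trilinear T v p v = trilinear T v v p"
      "trilinear T p w w = trilinear T w w p" "trilinear T w p w = trilinear T w w p"
      "trilinear T p p v = trilinear T v p p" "trilinear T p v p = trilinear T v p p"
      "trilinear T p p w = trilinear T w p p" "trilinear T p w p = trilinear T w p p"
      "trilinear T w v p = trilinear T v w p" "trilinear T w p v = trilinear T v w p" "trilinear T p v w = trilinear T v w p"
      "trilinear T p w v = trilinear T v w p" "trilinear T v p w = trilinear T v w p"
      using zero trilinear_symmetric[OF T(1)] by metis+
    show ?thesis unfolding trilinear_add trilinear_scale s zero by (simp add: algebra_simps power2_eq_square power3_eq_cube)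
  qed
  have "cubic_F u = cubic_F (flex_cubic l n q (trilinear T w w w))"
  proof
    fix y
    have "cubic_F u y = trilinear T (dot m y *s v + dot n y *s w + dot l y *s p)
       (dot m y *s v + dot n y *s w + dot l y *s p) (dot m y *s v + dot n y *s w + dot l y *s p)"
      unfolding FT using basis by metis
    thus "cubic_F u y = cubic_F (flex_cubic l n q (trilinear T w w w)) y"
      unfolding expand cubic_F_flex_cubic q by simp
  qed
  thus thesis using that cubic_F_injective \<open>cross n l = v\<close> by blast
qed

section \<open>Polynomial curves\<close>

definition polynomial_fun :: "(complex \<Rightarrow> complex) \<Rightarrow> bool" where
  "polynomial_fun f \<longleftrightarrow> f \<in> range poly"

lemma polynomial_fun_const: "polynomial_fun (\<lambda>z. c)"
  unfolding polynomial_fun_def by (rule range_eqI[of _ _ "[:c:]"]) auto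

lemma polynomial_fun_id: "polynomial_fun (\<lambda>z. z)"
  unfolding polynomial_fun_def by (rule range_eqI[of _ _ "[:0, 1:]"]) auto

lemma polynomial_fun_add:
  assumes "polynomial_fun f" "polynomial_fun g"
  shows "polynomial_fun (\<lambda>z. f z + g z)"
proof -
  obtain p q where "f = poly p" "g = poly q" using assms by (auto simp: polynomial_fun_def)
  thus ?thesis unfolding polynomial_fun_def by (intro range_eqI[of _ _ "p + q"]) auto
qed

lemma polynomial_fun_diff:
  assumes "polynomial_fun f" "polynomial_fun g"
  shows "polynomial_fun (\<lambda>z. f z - g z)"
proof -
  obtain p q where "f = poly p" "g = poly q" using assms by (auto simp: polynomial_fun_def)
  thus ?thesis unfolding polynomial_fun_def by (intro range_eqI[of _ _ "p - q"]) auto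
qed

lemma polynomial_fun_mult:
  assumes "polynomial_fun f" "polynomial_fun g"
  shows "polynomial_fun (\<lambda>z. f z * g z)"
proof -
  obtain p q where "f = poly p" "g = poly q" using assms by (auto simp: polynomial_fun_def)
  thus ?thesis unfolding polynomial_fun_def by (intro range_eqI[of _ _ "p * q"]) auto
qed

lemma polynomial_fun_sum:
  assumes "\<And>i. i \<in> I \<Longrightarrow> polynomial_fun (f i)"
  shows "polynomial_fun (\<lambda>z. \<Sum>i\<in>I. f i z)"
  using assms by (induction I rule: infinite_finite_induct)
    (auto intro: polynomial_fun_const polynomial_fun_add)

lemma polynomial_fun_prod:
  assumes "\<And>i. i \<in> I \<Longrightarrow> polynomial_fun (f i)"
  shows "polynomial_fun (\<lambda>z. \<Prod>i\<in>I. f i z)"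
  using assms by (induction I rule: infinite_finite_induct)
    (auto intro: polynomial_fun_const polynomial_fun_mult)

lemma polynomial_fun_power: "polynomial_fun f \<Longrightarrow> polynomial_fun (\<lambda>z. f z ^ n)"
  by (induction n) (auto intro: polynomial_fun_const polynomial_fun_mult)

lemmas polynomial_fun_intros = polynomial_fun_const polynomial_fun_id polynomial_fun_add
  polynomial_fun_diff polynomial_fun_mult polynomial_fun_sum polynomial_fun_prod polynomial_fun_power

text \<open>The ring of polynomials in one variable is an integral domain, and over an infinite field a nonzero
  polynomial is nonzero somewhere.\<close>
lemma polynomial_funs_common_nonzero:
  assumes "finite S" "\<forall>f\<in>S. polynomial_fun f" "\<forall>f\<in>S. \<exists>z. f z \<noteq> 0"
  shows "\<exists>z. \<forall>f\<in>S. f z \<noteq> 0"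
proof -
  obtain P where P: "\<And>f. f \<in> S \<Longrightarrow> f = poly (P f)"
  proof -
    have "\<forall>f\<in>S. \<exists>p. f = poly p" using assms(2) by (auto simp: polynomial_fun_def)
    thus thesis using that bchoice by metis
  qed
  have "P f \<noteq> 0" if "f \<in> S" for f
    using P[OF that] assms(3) that by (metis poly_0)
  hence "(\<Prod>f\<in>S. P f) \<noteq> 0" using assms(1) by simp
  then obtain z where z: "poly (\<Prod>f\<in>S. P f) z \<noteq> 0" using poly_all_0_iff_0 by blast
  have "f z \<noteq> 0" if f: "f \<in> S" for f
  proof -
    have "poly (P f) z \<noteq> 0" using z f assms(1) by (auto simp: poly_prod)
    thus ?thesis using P[OF f] by simp
  qed
  thus ?thesis by blast
qed

lemma polynomial_fun_bihomogeneous: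
  assumes "bihomogeneous d e f" and "\<And>i. polynomial_fun (\<lambda>z. u z $ i)" "\<And>i. polynomial_fun (\<lambda>z. v z $ i)"
  shows "polynomial_fun (\<lambda>z. f (u z) (v z))"
proof -
  obtain a where f: "\<And>u v. f u v = (\<Sum>p\<in>exponents d. \<Sum>q\<in>exponents e. a p q * monomial p u * monomial q v)"
    using assms(1) unfolding bihomogeneous_def by blast
  show ?thesis unfolding f monomial_def by (intro polynomial_fun_intros assms)
qed

lemma polynomial_fun_flex_cubic:
  assumes "\<And>i. polynomial_fun (\<lambda>z. l z $ i)" "\<And>i. polynomial_fun (\<lambda>z. n z $ i)"
    "\<And>i j. polynomial_fun (\<lambda>z. q z $ i $ j)" "polynomial_fun c"
  shows "polynomial_fun (\<lambda>z. flex_cubic (l z) (n z) (q z) (c z) $ e)"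
  unfolding flex_cubic_def cubic_of_tensor_def vec_lambda_beta
  by (intro polynomial_fun_intros assms)

lemma polynomial_fun_cross:
  assumes "\<And>i. polynomial_fun (\<lambda>z. l z $ i)" "\<And>i. polynomial_fun (\<lambda>z. n z $ i)"
  shows "polynomial_fun (\<lambda>z. cross (l z) (n z) $ i)"
  using exhaust_3[of i] by (auto simp: cross_def vector_3 intro!: polynomial_fun_intros assms)

lemma span_singleton_in_projective_space:
  "u \<noteq> 0 \<Longrightarrow> vec.span {u} \<in> projective_space"
  by (simp add: projective_space_def vec.dim_eq_card_independent)

lemma span_pair_in_flex_variety:
  assumes "u \<noteq> 0" "v \<noteq> 0" "cubic_F u v = 0" "hessian_H u v = 0"
  shows "(vec.span {u}, vec.span {v}) \<in> flex_variety"
proof -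
  have P: "vec.span {u} \<in> projective_space" "vec.span {v} \<in> projective_space"
    using assms by (simp_all add: span_singleton_in_projective_space)
  have "u \<in> vec.span {u} - {0}" "v \<in> vec.span {v} - {0}"
    using assms by (simp_all add: vec.span_base)
  hence "cubic_F u' v' = 0" "hessian_H u' v' = 0" if "u' \<in> vec.span {u} - {0}" "v' \<in> vec.span {v} - {0}" for u' v'
    using vanishes_at_representative[OF bihomogeneous_cubic_F P _ _ assms(3) that]
      vanishes_at_representative[OF bihomogeneous_hessian_H P _ _ assms(4) that] by simp_all
  thus ?thesis unfolding flex_variety_def zero_locus_def using P by simp
qed

text \<open>The parameters of the two flexes are joined by a line segment. The curve may meet the
  zero vector in either factor, where it determines no flex; hence the two conditions in the last
  clause.\<close>
lemma flexes_joined_by_polynomial_curve: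
  assumes "(L, M) \<in> flex_variety" "(L', M') \<in> flex_variety"
  obtains u v where "\<And>i. polynomial_fun (\<lambda>z. u z $ i)" "\<And>i. polynomial_fun (\<lambda>z. v z $ i)"
    "u 0 \<in> L - {0}" "v 0 \<in> M - {0}" "u 1 \<in> L' - {0}" "v 1 \<in> M' - {0}"
    "\<And>z. u z \<noteq> 0 \<Longrightarrow> v z \<noteq> 0 \<Longrightarrow> (vec.span {u z}, vec.span {v z}) \<in> flex_variety"
proof -
  have par: "\<exists>l n q c. flex_cubic l n q c \<in> L - {0} \<and> cross n l \<in> M - {0}" if LM: "(L, M) \<in> flex_variety" for L M
  proof -
    have LM': "L \<in> projective_space" "M \<in> projective_space"
      using LM by (simp_all add: flex_variety_def zero_locus_def)
    obtain u where u: "u \<in> L - {0}" using projective_space_nonzero[OF LM'(1)] by blast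
    obtain v where v: "v \<in> M - {0}" using projective_space_nonzero[OF LM'(2)] by blast
    note uv = u v
    moreover have "cubic_F u v = 0" "hessian_H u v = 0"
      using LM uv by (auto simp: flex_variety_def zero_locus_def)
    ultimately show ?thesis using flex_is_flex_cubic[of v u] by (metis DiffE singletonI)
  qed
  obtain l n q c where 0: "flex_cubic l n q c \<in> L - {0}" "cross n l \<in> M - {0}"
    using par[OF assms(1)] by blast
  obtain l' n' q' c' where 1: "flex_cubic l' n' q' c' \<in> L' - {0}" "cross n' l' \<in> M' - {0}"
    using par[OF assms(2)] by blast
  define lz where "lz = (\<lambda>z. \<chi> i. l $ i + z * (l' $ i - l $ i))"
  define nz where "nz = (\<lambda>z. \<chi> i. n $ i + z * (n' $ i - n $ i))"
  define qz where "qz = (\<lambda>z. \<chi> i j. q $ i $ j + z * (q' $ i $ j - q $ i $ j))"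
  define cz where "cz = (\<lambda>z. c + z * (c' - c))"
  have ends: "lz 0 = l" "nz 0 = n" "qz 0 = q" "cz 0 = c" "lz 1 = l'" "nz 1 = n'" "qz 1 = q'" "cz 1 = c'"
    by (simp_all add: lz_def nz_def qz_def cz_def)
  have pol: "polynomial_fun (\<lambda>z. lz z $ i)" "polynomial_fun (\<lambda>z. nz z $ i)"
      "polynomial_fun (\<lambda>z. qz z $ i $ j)" "polynomial_fun cz" for i j
    unfolding lz_def nz_def qz_def cz_def vec_lambda_beta by (intro polynomial_fun_intros)+
  show thesis
  proof (rule that)
    show "polynomial_fun (\<lambda>z. flex_cubic (lz z) (nz z) (qz z) (cz z) $ e)" for e
      by (intro polynomial_fun_flex_cubic pol)
    show "polynomial_fun (\<lambda>z. cross (nz z) (lz z) $ i)" for i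
      by (intro polynomial_fun_cross pol)
    fix z
    let ?u = "flex_cubic (lz z) (nz z) (qz z) (cz z)" and ?v = "cross (nz z) (lz z)"
    assume nonzero: "?u \<noteq> 0" "?v \<noteq> 0"
    thus "(vec.span {?u}, vec.span {?v}) \<in> flex_variety"
      by (rule span_pair_in_flex_variety) (rule flex_cubic_flex)+
  qed (use 0 1 ends in auto)
qed

section \<open>Irreducibility\<close>

lemma flex_variety_nonempty: "flex_variety \<noteq> {}"
proof -
  let ?l = "vector [1, 0, 0] :: complex ^ 3" and ?n = "vector [0, 1, 0] :: complex ^ 3"
  let ?u = "flex_cubic ?l ?n 0 1" and ?v = "cross ?n ?l"
  have "cubic_F ?u ?n \<noteq> 0"
    by (simp add: cubic_F_flex_cubic scalar_product_def sum_3 vector_3)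
  hence u: "?u \<noteq> 0" by (auto simp: cubic_F_def)
  have v: "?v \<noteq> 0" by (simp add: cross_def vec_eq_iff forall_3 vector_3)
  have "(vec.span {?u}, vec.span {?v}) \<in> flex_variety"
    using u v by (rule span_pair_in_flex_variety) (rule flex_cubic_flex)+
  thus ?thesis by blast
qed

lemma separating_biform:
  assumes "closedin zariski_biprojective C" "(L, M) \<in> projective_space \<times> projective_space" "(L, M) \<notin> C"
  obtains d e f where "bihomogeneous d e f" "\<And>u v. u \<in> L - {0} \<Longrightarrow> v \<in> M - {0} \<Longrightarrow> f u v \<noteq> 0"
    "\<And>L' M' u v. (L', M') \<in> C \<Longrightarrow> u \<in> L' - {0} \<Longrightarrow> v \<in> M' - {0} \<Longrightarrow> f u v = 0"
proof -
  obtain T where T: "T \<subseteq> biforms" "C = zero_locus T" using assms(1) closedin_zariski by blast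
  then obtain f u v where f: "f \<in> T" "u \<in> L - {0}" "v \<in> M - {0}" "f u v \<noteq> 0"
    using assms(2,3) unfolding zero_locus_def by blast
  then obtain d e where de: "bihomogeneous d e f" using T by (auto simp: biforms_def)
  show thesis
  proof (rule that[OF de])
    show "f u' v' \<noteq> 0" if "u' \<in> L - {0}" "v' \<in> M - {0}" for u' v'
      using vanishes_at_representative[OF de _ _ that] f assms(2) by blast
    show "f u v = 0" if "(L', M') \<in> C" "u \<in> L' - {0}" "v \<in> M' - {0}" for L' M' u v
      using that f(1) T(2) by (auto simp: zero_locus_def)
  qed
qed

theorem theorem1:
  shows "irreducible_space (subtopology zariski_biprojective flex_variety)"
proof -
  have top: "topspace (subtopology zariski_biprojective flex_variety) = flex_variety"
    using closedin_subset[OF closedin_flex_variety] by auto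
  have closed: "closedin (subtopology zariski_biprojective flex_variety) A \<longleftrightarrow>
      closedin zariski_biprojective A \<and> A \<subseteq> flex_variety" for A
    by (rule closedin_closed_subtopology[OF closedin_flex_variety])
  show ?thesis unfolding irreducible_space_def top closed
  proof (intro conjI allI impI flex_variety_nonempty)
    fix A B
    assume AB: "(closedin zariski_biprojective A \<and> A \<subseteq> flex_variety) \<and>
      (closedin zariski_biprojective B \<and> B \<subseteq> flex_variety) \<and> A \<union> B = flex_variety"
    show "A = flex_variety \<or> B = flex_variety"
    proof (rule ccontr)
      assume "\<not> (A = flex_variety \<or> B = flex_variety)"
      then obtain L M L' M' where P: "(L, M) \<in> flex_variety" "(L, M) \<notin> A" "(L', M') \<in> flex_variety" "(L', M') \<notin> B"
        using AB by auto
      hence proj: "(L, M) \<in> projective_space \<times> projective_space" "(L', M') \<in> projective_space \<times> projective_space"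
        unfolding flex_variety_def using zero_locus_subset by blast+
      obtain d e f where f: "bihomogeneous d e f"
        "\<And>u v. u \<in> L - {0} \<Longrightarrow> v \<in> M - {0} \<Longrightarrow> f u v \<noteq> 0"
        "\<And>L' M' u v. (L', M') \<in> A \<Longrightarrow> u \<in> L' - {0} \<Longrightarrow> v \<in> M' - {0} \<Longrightarrow> f u v = 0"
        using separating_biform[of A L M] AB proj(1) P(2) by blast
      obtain d' e' g where g: "bihomogeneous d' e' g"
        "\<And>u v. u \<in> L' - {0} \<Longrightarrow> v \<in> M' - {0} \<Longrightarrow> g u v \<noteq> 0"
        "\<And>L' M' u v. (L', M') \<in> B \<Longrightarrow> u \<in> L' - {0} \<Longrightarrow> v \<in> M' - {0} \<Longrightarrow> g u v = 0"
        using separating_biform[of B L' M'] AB proj(2) P(4) by blast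
      obtain u v where uv: "\<And>i. polynomial_fun (\<lambda>z. u z $ i)" "\<And>i. polynomial_fun (\<lambda>z. v z $ i)"
        "u 0 \<in> L - {0}" "v 0 \<in> M - {0}" "u 1 \<in> L' - {0}" "v 1 \<in> M' - {0}"
        "\<And>z. u z \<noteq> 0 \<Longrightarrow> v z \<noteq> 0 \<Longrightarrow> (vec.span {u z}, vec.span {v z}) \<in> flex_variety"
        using flexes_joined_by_polynomial_curve[OF P(1,3)] by blast
      obtain i j where ij: "u 0 $ i \<noteq> 0" "v 0 $ j \<noteq> 0"
        using uv(3,4) by (auto simp: vec_eq_iff)
      have fg: "f (u 0) (v 0) \<noteq> 0" "g (u 1) (v 1) \<noteq> 0" using f(2) g(2) uv(3-6) by simp_all
      \<comment> \<open>The coordinates \<open>i\<close> and \<open>j\<close> keep the curve away from zero vectors.\<close>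
      let ?S = "{\<lambda>z. f (u z) (v z), \<lambda>z. g (u z) (v z), \<lambda>z. u z $ i, \<lambda>z. v z $ j}"
      have pol: "\<forall>h\<in>?S. polynomial_fun h"
        using polynomial_fun_bihomogeneous[OF f(1) uv(1,2)] polynomial_fun_bihomogeneous[OF g(1) uv(1,2)]
          uv(1,2) by simp
      have nz: "\<forall>h\<in>?S. \<exists>z. h z \<noteq> 0"
        unfolding ball_simps using fg ij by blast
      have "\<exists>z. \<forall>h\<in>?S. h z \<noteq> 0"
        by (rule polynomial_funs_common_nonzero[OF _ pol nz]) simp
      then obtain z where "\<forall>h\<in>?S. h z \<noteq> 0" ..
      hence z: "f (u z) (v z) \<noteq> 0" "g (u z) (v z) \<noteq> 0" "u z $ i \<noteq> 0" "v z $ j \<noteq> 0"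
        by simp_all
      have nonzero: "u z \<noteq> 0" "v z \<noteq> 0" using z(3,4) by auto
      have "u z \<in> vec.span {u z} - {0}" "v z \<in> vec.span {v z} - {0}"
        using nonzero vec.span_base by blast+
      hence "(vec.span {u z}, vec.span {v z}) \<notin> A \<union> B" using f(3) g(3) z(1,2) by blast
      thus False using uv(7)[OF nonzero] AB by blast
    qed
  qed
qed

end
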